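(* For every integer $n\ge 2$ there is $C_n'>0$ such that the following holds. Let $m=\operatorname{ES}_l(n)$, and let $\mathcal F$ be a finite family of lines in general position in $\mathbb{R}^2$ that is partitioned into nonempty subsets $\mathcal F_1,\dots,\mathcal F_m$. Then there are $n$ subscripts $1\le j_1<j_2<\dots<j_n\le m$ and subsets $\mathcal H_{j_i}\subset\mathcal F_{j_i}$ with $|\mathcal H_{j_i}|\ge C_n'|\mathcal F_{j_i}|$ for all $i=1,\dots,n$, such that every transversal of the system $\mathcal H_{j_1},\dots,\mathcal H_{j_n}$ defines an $n$-cell.
   Context: A finite family of lines in $\mathbb{R}^2$ is in general position if no three lines are concurrent, no two are parallel, and no line is vertical. A family of $n\ge 2$ lines in general position defines an $n$-cell (equivalently, is in convex position) if some connected component $P$ of the complement of the union of these $n$ lines has the property that its boundary contains a segment (of positive length, possibly a half-line) from each of the $n$ lines; $P$ may be bounded or unbounded. For $n\ge 2$, $\operatorname{ES}_l(n)$ denotes the smallest number such that every family of at least $\operatorname{ES}_l(n)$ lines in general position in $\mathbb{R}^2$ contains $n$ lines that define an $n$-cell (this number exists). Given families of lines $\mathcal G_1,\dots,\mathcal G_n$, a transversal is a set $\{a_1,\dots,a_n\}$ with $a_i\in\mathcal G_i$ for every $i$. *)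

theory Defs
  imports "HOL-Analysis.Analysis"
begin

definition is_line :: "(real^2) set \<Rightarrow> bool" where
  "is_line L \<longleftrightarrow> affine L \<and> aff_dim L = 1"

definition vertical :: "(real^2) set \<Rightarrow> bool" where
  "vertical L \<longleftrightarrow> (\<exists>c. L = {p. p $ 1 = c})"

text \<open>Finiteness is part of the notion: only finite families are considered.\<close>

definition general_position :: "(real^2) set set \<Rightarrow> bool" where
  "general_position F \<longleftrightarrow>
     finite F \<and> (\<forall>L\<in>F. is_line L) \<and>
     (\<forall>L\<in>F. \<forall>M\<in>F. \<forall>K\<in>F. L \<noteq> M \<and> M \<noteq> K \<and> L \<noteq> K \<longrightarrow> L \<inter> M \<inter> K = {}) \<and>
     (\<forall>L\<in>F. \<forall>M\<in>F. L \<noteq> M \<longrightarrow> \<not> affine_parallel L M) \<and>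
     (\<forall>L\<in>F. \<not> vertical L)"

text \<open>A half-line in the boundary contains a nondegenerate closed segment, so asking
  for such a segment covers the bounded and the unbounded case.\<close>

definition defines_cell :: "nat \<Rightarrow> (real^2) set set \<Rightarrow> bool" where
  "defines_cell n G \<longleftrightarrow>
     n \<ge> 2 \<and> card G = n \<and> general_position G \<and>
     (\<exists>P \<in> components (- \<Union>G). \<forall>L\<in>G. \<exists>a b. a \<noteq> b \<and> closed_segment a b \<subseteq> L \<inter> frontier P)"

definition ES\<^sub>l :: "nat \<Rightarrow> nat" where
  "ES\<^sub>l n = (LEAST N. \<forall>F. general_position F \<and> card F \<ge> N \<longrightarrow> (\<exists>G\<subseteq>F. defines_cell n G))"

definition transversal :: "nat \<Rightarrow> (nat \<Rightarrow> 'a set) \<Rightarrow> 'a set \<Rightarrow> bool" where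
  "transversal n G T \<longleftrightarrow> (\<exists>a. (\<forall>i\<in>{1..n}. a i \<in> G i) \<and> T = a ` {1..n})"

end

theory Submission
  imports Defs "HOL-Library.Ramsey"
begin

text \<open>
  Whether lines in general position define a cell depends only on their order type: the order of
  the slopes and, for each triple, the sign of a determinant that tells on which side of the
  crossing of two lines the third one passes. Indeed, a cell chooses a side of each line, and a
  line \<open>L\<close> contributes an edge iff some point of \<open>L\<close> lies strictly on
  the chosen sides of all other lines. Each other line restricts this point to an open ray of
  \<open>L\<close>, and by Helly's theorem in dimension one it suffices to compare the rays in
  pairs, which involves three lines at a time (\<open>visible_sides_iff\<close>,
  \<open>defines_cell_same_order_type\<close>).

  It is therefore enough to shrink the families, by a factor that depends on their number only,
  until all transversals have the same order type. This is the same-type lemma of Barany and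
  Valtr (\<open>same_type_lemma\<close>). It needs only two kinds of steps. Cutting two families
  at their median slopes separates their slopes. For three families with separated slopes, a
  point that halves both the flattest and the steepest one exists by the intermediate value
  theorem, and the half of the middle family on one side of this point decides the orientation
  (\<open>uniform_orientation_three_families\<close>).

  After shrinking, one transversal of all \<open>m\<close> families is a family of
  \<open>ES\<^sub>l n\<close> lines and contains \<open>n\<close> lines that define a cell. The
  indices of these lines work for all other transversals, since the order type is the same. The
  number \<open>ES\<^sub>l n\<close> has the property that defines it because Ramsey's theorem
  for triples produces uniformly oriented, hence convex, subfamilies
  (\<open>erdos_szekeres_lines\<close>).
\<close>

section \<open>Medians of finite sets\<close>

text \<open>The min-max form of the lower median: the smallest value below which (weakly) half of the set,
  rounded up, can be found. In this form it visibly depends continuously on the values of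
  \<open>f\<close>, which a definition by sorting would hide.\<close>
definition median :: "('a \<Rightarrow> real) \<Rightarrow> 'a set \<Rightarrow> real" where
  "median f A = Min ((\<lambda>S. Max (f ` S)) ` {S. S \<subseteq> A \<and> card S = (card A + 1) div 2})"

lemma median_choices:
  assumes "finite A" "A \<noteq> {}"
  shows "finite {S. S \<subseteq> A \<and> card S = (card A + 1) div 2}"
    and "{S. S \<subseteq> A \<and> card S = (card A + 1) div 2} \<noteq> {}"
    and "\<And>S. S \<subseteq> A \<Longrightarrow> card S = (card A + 1) div 2 \<Longrightarrow> finite S \<and> S \<noteq> {}"
proof -
  have pos: "card A > 0"
    using assms by (simp add: card_gt_0_iff)
  show "finite {S. S \<subseteq> A \<and> card S = (card A + 1) div 2}"
    using assms by simp
  have "(card A + 1) div 2 \<le> card A"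
    using pos by linarith
  then obtain T where "T \<subseteq> A" "card T = (card A + 1) div 2"
    by (rule obtain_subset_with_card_n)
  then have "T \<in> {S. S \<subseteq> A \<and> card S = (card A + 1) div 2}"
    by simp
  then show "{S. S \<subseteq> A \<and> card S = (card A + 1) div 2} \<noteq> {}"
    by (metis empty_iff)
  fix S assume "S \<subseteq> A" "card S = (card A + 1) div 2"
  then have "card S > 0"
    using pos by linarith
  then show "finite S \<and> S \<noteq> {}"
    by (simp add: card_gt_0_iff)
qed

lemma card_le_median:
  assumes "finite A" "A \<noteq> {}"
  shows "real (card A) / 2 \<le> real (card {a \<in> A. f a \<le> median f A})"
proof -
  have "median f A \<in> (\<lambda>S. Max (f ` S)) ` {S. S \<subseteq> A \<and> card S = (card A + 1) div 2}"
    unfolding median_def using median_choices(1,2)[OF assms] by (intro Min_in) auto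
  then obtain S where S: "S \<subseteq> A" "card S = (card A + 1) div 2" "median f A = Max (f ` S)"
    by auto
  have "S \<subseteq> {a \<in> A. f a \<le> median f A}"
    using S median_choices(3)[OF assms S(1,2)] by auto
  then have "card S \<le> card {a \<in> A. f a \<le> median f A}"
    using assms by (intro card_mono) auto
  then show ?thesis
    using S(2) by linarith
qed

lemma card_ge_median:
  assumes "finite A" "A \<noteq> {}"
  shows "real (card A) / 2 \<le> real (card {a \<in> A. median f A \<le> f a})"
proof (rule ccontr)
  assume *: "\<not> ?thesis"
  let ?below = "{a \<in> A. f a < median f A}" and ?above = "{a \<in> A. median f A \<le> f a}"
  have "?below \<union> ?above = A" "?below \<inter> ?above = {}"
    by auto
  then have "card A = card ?below + card ?above"
    using card_Un_disjoint[of ?below ?above] \<open>finite A\<close> by simp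
  then have "(card A + 1) div 2 \<le> card {a \<in> A. f a < median f A}"
    using * by linarith
  then obtain S where S: "S \<subseteq> {a \<in> A. f a < median f A}" "card S = (card A + 1) div 2"
    by (rule obtain_subset_with_card_n)
  then have SA: "S \<subseteq> A" and "finite S \<and> S \<noteq> {}"
    using median_choices(3)[OF assms _ S(2)] by auto
  then have "Max (f ` S) < median f A"
    using S by auto
  moreover have "median f A \<le> Max (f ` S)"
    unfolding median_def using median_choices(1)[OF assms] SA S(2) by (intro Min_le) auto
  ultimately show False by simp
qed

lemma continuous_on_Max_image:
  fixes f :: "'b::topological_space \<Rightarrow> 'a \<Rightarrow> real"
  assumes "finite S" "S \<noteq> {}" "\<And>a. a \<in> S \<Longrightarrow> continuous_on U (\<lambda>u. f u a)"
  shows "continuous_on U (\<lambda>u. Max (f u ` S))"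
  using assms by (induction S rule: finite_ne_induct) (simp_all add: continuous_on_max)

lemma continuous_on_Min_image:
  fixes f :: "'b::topological_space \<Rightarrow> 'a \<Rightarrow> real"
  assumes "finite S" "S \<noteq> {}" "\<And>a. a \<in> S \<Longrightarrow> continuous_on U (\<lambda>u. f u a)"
  shows "continuous_on U (\<lambda>u. Min (f u ` S))"
  using assms by (induction S rule: finite_ne_induct) (simp_all add: continuous_on_min)

lemma continuous_on_median:
  fixes f :: "'b::topological_space \<Rightarrow> 'a \<Rightarrow> real"
  assumes "finite A" "A \<noteq> {}" and f: "\<And>a. a \<in> A \<Longrightarrow> continuous_on U (\<lambda>u. f u a)"
  shows "continuous_on U (\<lambda>u. median (f u) A)"
  unfolding median_def
proof (rule continuous_on_Min_image[OF median_choices(1,2)[OF assms(1,2)]])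
  fix S assume "S \<in> {S. S \<subseteq> A \<and> card S = (card A + 1) div 2}"
  then have S: "S \<subseteq> A" "finite S \<and> S \<noteq> {}"
    using median_choices(3)[OF assms(1,2), of S] by simp_all
  show "continuous_on U (\<lambda>u. Max (f u ` S))"
    by (rule continuous_on_Max_image) (use S f in auto)
qed

lemma median_less_median:
  assumes "finite A" "A \<noteq> {}" "finite B" "B \<noteq> {}"
    and "\<And>a b. a \<in> A \<Longrightarrow> b \<in> B \<Longrightarrow> f a < g b"
  shows "median f A < median g B"
proof -
  have "card A > 0" "card B > 0"
    using assms by (auto simp: card_gt_0_iff)
  then have "card {b \<in> B. g b \<le> median g B} > 0" "card {a \<in> A. median f A \<le> f a} > 0"
    using card_le_median[OF assms(3,4), of g] card_ge_median[OF assms(1,2), of f] by linarith+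
  then have "{b \<in> B. g b \<le> median g B} \<noteq> {}" "{a \<in> A. median f A \<le> f a} \<noteq> {}"
    by force+
  then obtain a b where "b \<in> B" "g b \<le> median g B" "a \<in> A" "median f A \<le> f a"
    by blast
  then show ?thesis
    using assms(5)[of a b] by linarith
qed

text \<open>Cut both sets at their medians, and keep the lower half of the set with the smaller median and
  the upper half of the other.\<close>
lemma separate_two_sets:
  fixes f :: "'a \<Rightarrow> real"
  assumes "finite A" "A \<noteq> {}" "finite B" "B \<noteq> {}"
    and "\<And>a b. a \<in> A \<Longrightarrow> b \<in> B \<Longrightarrow> f a \<noteq> f b"
  obtains A' B' where "A' \<subseteq> A" "B' \<subseteq> B"
    "real (card A) / 2 \<le> real (card A')" "real (card B) / 2 \<le> real (card B')"
    "(\<forall>a\<in>A'. \<forall>b\<in>B'. f a < f b) \<or> (\<forall>a\<in>A'. \<forall>b\<in>B'. f b < f a)"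
proof (cases "median f A \<le> median f B")
  case True
  show ?thesis
  proof (rule that)
    show "(\<forall>a\<in>{a \<in> A. f a \<le> median f A}. \<forall>b\<in>{b \<in> B. median f B \<le> f b}. f a < f b) \<or>
        (\<forall>a\<in>{a \<in> A. f a \<le> median f A}. \<forall>b\<in>{b \<in> B. median f B \<le> f b}. f b < f a)"
      using True assms(5) by (smt (verit, best) mem_Collect_eq)
  qed (auto intro: card_le_median[OF assms(1,2)] card_ge_median[OF assms(1,2)]
      card_le_median[OF assms(3,4)] card_ge_median[OF assms(3,4)] simp del: divide_le_eq_numeral1)
next
  case False
  show ?thesis
  proof (rule that)
    show "(\<forall>a\<in>{a \<in> A. median f A \<le> f a}. \<forall>b\<in>{b \<in> B. f b \<le> median f B}. f a < f b) \<or>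
        (\<forall>a\<in>{a \<in> A. median f A \<le> f a}. \<forall>b\<in>{b \<in> B. f b \<le> median f B}. f b < f a)"
      using False by fastforce
  qed (auto intro: card_le_median[OF assms(1,2)] card_ge_median[OF assms(1,2)]
      card_le_median[OF assms(3,4)] card_ge_median[OF assms(3,4)] simp del: divide_le_eq_numeral1)
qed

section \<open>Lines, slopes and orientations\<close>

text \<open>A non-vertical line is the graph of an affine function, and is dual to the point (slope,
  intercept). The three functions below are meaningful for non-vertical lines only.\<close>
definition slope :: "(real^2) set \<Rightarrow> real" where
  "slope L = (SOME s. \<exists>t. L = {p. p $ 2 = s * p $ 1 + t})"

definition intercept :: "(real^2) set \<Rightarrow> real" where
  "intercept L = (SOME t. L = {p. p $ 2 = slope L * p $ 1 + t})"

definition height :: "(real^2) set \<Rightarrow> real \<Rightarrow> real" where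
  "height L x = slope L * x + intercept L"

text \<open>Twice the signed area of the triangle formed by the dual points. For increasing slopes it is
  negative exactly when the middle line passes above the crossing of the other two.\<close>
definition orient :: "(real^2) set \<Rightarrow> (real^2) set \<Rightarrow> (real^2) set \<Rightarrow> real" where
  "orient L M K = (slope M - slope L) * (intercept K - intercept L)
                - (slope K - slope L) * (intercept M - intercept L)"

lemma orient_swap: "orient M L K = - orient L M K" "orient L K M = - orient L M K"
  by (simp_all add: orient_def algebra_simps)

text \<open>A shear changes slopes and heights but not areas, so the intercepts, which are the heights at
  \<open>0\<close>, may be replaced by the heights at any \<open>x\<close>.\<close>
lemma orient_heights:
  "orient L M K = (slope M - slope L) * (height K x - height L x)
                - (slope K - slope L) * (height M x - height L x)"
  by (simp add: orient_def height_def algebra_simps)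

lemma non_vertical_line_graph:
  assumes "is_line L" "\<not> vertical L"
  shows "L = {p. p $ 2 = height L (p $ 1)}"
proof -
  have "affine L" "aff_dim L = int DIM(real^2) - 1"
    using assms(1) by (simp_all add: is_line_def)
  then obtain a b where a: "a \<noteq> 0" and "affine hull L = {p. a \<bullet> p = b}"
    using aff_dim_eq_hyperplane[of L] by auto
  then have L: "L = {p. a $ 1 * p $ 1 + a $ 2 * p $ 2 = b}"
    using \<open>affine L\<close> by (simp add: inner_vec_def sum_2 affine_hull_eq[THEN iffD2])
  have "a $ 2 \<noteq> 0"
  proof
    assume "a $ 2 = 0"
    then have "a $ 1 \<noteq> 0"
      using a by (metis (full_types) exhaust_2 vec_eq_iff zero_index)
    then have "L = {p. p $ 1 = b / a $ 1}"
      using \<open>a $ 2 = 0\<close> unfolding L by (simp add: field_simps)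
    then show False
      using assms(2) unfolding vertical_def by metis
  qed
  then have "L = {p. p $ 2 = (- a $ 1 / a $ 2) * p $ 1 + b / a $ 2}"
    unfolding L by (simp add: field_simps)
  then have "\<exists>s t. L = {p. p $ 2 = s * p $ 1 + t}"
    by (intro exI)
  then have "\<exists>t. L = {p. p $ 2 = slope L * p $ 1 + t}"
    unfolding slope_def by (rule someI_ex)
  then show ?thesis
    unfolding height_def intercept_def by (rule someI_ex)
qed

lemma general_position_graph:
  assumes "general_position G" "L \<in> G"
  shows "p \<in> L \<longleftrightarrow> p $ 2 = height L (p $ 1)"
proof -
  have "L = {p. p $ 2 = height L (p $ 1)}"
    using assms by (intro non_vertical_line_graph) (simp_all add: general_position_def)
  from arg_cong[OF this, of "\<lambda>S. p \<in> S"] show ?thesis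
    by (simp only: mem_Collect_eq)
qed

lemma general_position_slope_neq:
  assumes "general_position G" "L \<in> G" "M \<in> G" "L \<noteq> M"
  shows "slope L \<noteq> slope M"
proof
  assume eq: "slope L = slope M"
  define d :: "real^2" where "d = vector [0, intercept M - intercept L]"
  have shift: "q \<in> M \<longleftrightarrow> q - d \<in> L" for q
    using general_position_graph[OF assms(1,2), of "q - d"]
      general_position_graph[OF assms(1,3), of q] eq
    by (simp add: d_def height_def algebra_simps)
  have "M = (\<lambda>p. d + p) ` L"
  proof (intro set_eqI iffI)
    fix q assume "q \<in> M"
    then show "q \<in> (\<lambda>p. d + p) ` L"
      by (intro image_eqI[of q _ "q - d"]) (simp, rule shift[THEN iffD1])
  next
    fix q assume "q \<in> (\<lambda>p. d + p) ` L"
    then obtain p where "p \<in> L" "q = d + p"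
      by (rule imageE)
    then show "q \<in> M"
      by (intro shift[THEN iffD2]) simp
  qed
  then have "affine_parallel L M"
    unfolding affine_parallel_def by (rule exI)
  then show False
    using assms by (simp add: general_position_def)
qed

lemma general_position_orient_neq:
  assumes gp: "general_position G" "L \<in> G" "M \<in> G" "K \<in> G"
    and distinct: "L \<noteq> M" "M \<noteq> K" "L \<noteq> K"
  shows "orient L M K \<noteq> 0"
proof
  assume zero: "orient L M K = 0"
  have neq: "slope L \<noteq> slope M"
    using general_position_slope_neq[OF gp(1-3) distinct(1)] .
  define x where "x = (intercept L - intercept M) / (slope M - slope L)"
  have x: "(slope M - slope L) * x = intercept L - intercept M"
    using neq by (simp add: x_def)
  then have LM: "height M x = height L x"
    by (simp add: height_def algebra_simps)
  with zero have "(slope M - slope L) * (height K x - height L x) = 0"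
    by (simp add: orient_heights[where x = x])
  with neq have LK: "height K x = height L x"
    by simp
  define p :: "real^2" where "p = vector [x, height L x]"
  have "p \<in> L" "p \<in> M" "p \<in> K"
    using LM LK gp by (simp_all add: p_def general_position_graph[OF gp(1)])
  moreover have "L \<inter> M \<inter> K = {}"
    using gp distinct by (simp add: general_position_def)
  ultimately show False
    by blast
qed

lemma general_position_subset:
  assumes "general_position F" "G \<subseteq> F"
  shows "general_position G"
  using assms finite_subset[OF assms(2)] unfolding general_position_def by (simp add: subset_iff)

section \<open>The same-type lemma for lines\<close>

text \<open>Because \<open>C\<close> is steeper than \<open>A\<close>, all lines of \<open>C\<close> run
  below all lines of \<open>A\<close> far to the left and above them far to the right. The
  median height of \<open>C\<close> therefore overtakes that of \<open>A\<close> somewhere. The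
  point at that height has half of \<open>A\<close> and half of \<open>C\<close> weakly on
  either side of it; dually it is a line that halves two separated point sets.\<close>
lemma ham_sandwich_point:
  assumes "finite A" "A \<noteq> {}" "finite C" "C \<noteq> {}"
    and slopes: "\<And>a c. a \<in> A \<Longrightarrow> c \<in> C \<Longrightarrow> slope a < slope c"
  obtains x where "median (\<lambda>L. height L x) A = median (\<lambda>L. height L x) C"
proof -
  \<comment> \<open>The horizontal coordinate of the crossing of two lines.\<close>
  define cross where "cross = (\<lambda>(a, c). (intercept a - intercept c) / (slope c - slope a))"
  define X where "X = cross ` (A \<times> C)"
  have fin: "finite X" "X \<noteq> {}"
    using assms by (auto simp: X_def)
  have cross: "cross (a, c) \<in> X" "0 < slope c - slope a"
      "height c x - height a x = (slope c - slope a) * (x - cross (a, c))"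
    if "a \<in> A" "c \<in> C" for a c x
    using that slopes[OF that] by (auto simp: X_def cross_def height_def field_simps)
  define d where "d x = median (\<lambda>L. height L x) C - median (\<lambda>L. height L x) A" for x
  have "d (Min X - 1) < 0"
    unfolding d_def
  proof (simp, intro median_less_median assms)
    fix c a assume ac: "c \<in> C" "a \<in> A"
    have "Min X \<le> cross (a, c)"
      using fin cross(1)[OF ac(2,1)] by simp
    then have "(slope c - slope a) * (Min X - 1 - cross (a, c)) < 0"
      using cross(2)[OF ac(2,1)] by (intro mult_pos_neg) auto
    then show "height c (Min X - 1) < height a (Min X - 1)"
      using cross(3)[OF ac(2,1), of "Min X - 1"] by linarith
  qed
  moreover have "0 < d (Max X + 1)"
    unfolding d_def
  proof (simp, intro median_less_median assms)
    fix a c assume ac: "a \<in> A" "c \<in> C"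
    have "cross (a, c) \<le> Max X"
      using fin cross(1)[OF ac] by simp
    then have "0 < (slope c - slope a) * (Max X + 1 - cross (a, c))"
      using cross(2)[OF ac] by (intro mult_pos_pos) auto
    then show "height a (Max X + 1) < height c (Max X + 1)"
      using cross(3)[OF ac, of "Max X + 1"] by linarith
  qed
  moreover have "continuous_on {Min X - 1..Max X + 1} d"
    unfolding d_def height_def using assms
    by (intro continuous_intros continuous_on_median) auto
  moreover have "Min X - 1 \<le> Max X + 1"
    using fin Max_ge[OF fin(1) Min_in[OF fin]] by linarith
  ultimately obtain x where "d x = 0"
    using IVT'[of d "Min X - 1" 0 "Max X + 1"] by (meson less_imp_le)
  then show ?thesis
    using that[of x] by (simp add: d_def)
qed

text \<open>A point that lies weakly below the middle line and weakly above the two outer ones is a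
  certificate that the middle line passes above the crossing of the outer ones. The next lemma
  is the mirror image.\<close>
lemma orient_nonpos_if_above:
  assumes "slope L < slope M" "slope M < slope K"
    and "height L x \<le> y" "y \<le> height M x" "height K x \<le> y"
  shows "orient L M K \<le> 0"
proof -
  have "(slope M - slope L) * (height K x - height L x)
      \<le> (slope M - slope L) * (height M x - height L x)"
    using assms by (intro mult_left_mono) auto
  also have "\<dots> \<le> (slope K - slope L) * (height M x - height L x)"
    using assms by (intro mult_right_mono) auto
  finally show ?thesis
    by (simp add: orient_heights[where x = x])
qed

lemma orient_nonneg_if_below:
  assumes "slope L < slope M" "slope M < slope K"
    and "y \<le> height L x" "height M x \<le> y" "y \<le> height K x"
  shows "0 \<le> orient L M K"
proof -
  have "(slope K - slope L) * (height M x - height L x)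
      \<le> (slope M - slope L) * (height M x - height L x)"
    using assms by (intro mult_right_mono_neg) auto
  also have "\<dots> \<le> (slope M - slope L) * (height K x - height L x)"
    using assms by (intro mult_left_mono) auto
  finally show ?thesis
    by (simp add: orient_heights[where x = x])
qed

text \<open>At a point that halves \<open>A\<close> and \<open>C\<close>, half of \<open>B\<close> lies on
  one side. Together with the halves of \<open>A\<close> and \<open>C\<close> on the other side
  it forms triples that all have this point as a certificate of their orientation.\<close>
lemma uniform_orientation_three_families:
  assumes "finite A" "A \<noteq> {}" "finite B" "B \<noteq> {}" "finite C" "C \<noteq> {}"
    and AB: "\<And>a b. a \<in> A \<Longrightarrow> b \<in> B \<Longrightarrow> slope a < slope b"
    and BC: "\<And>b c. b \<in> B \<Longrightarrow> c \<in> C \<Longrightarrow> slope b < slope c"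
    and nz: "\<And>a b c. a \<in> A \<Longrightarrow> b \<in> B \<Longrightarrow> c \<in> C \<Longrightarrow> orient a b c \<noteq> 0"
  obtains A' B' C' where "A' \<subseteq> A" "B' \<subseteq> B" "C' \<subseteq> C"
    "real (card A) / 2 \<le> real (card A')" "real (card B) / 2 \<le> real (card B')"
    "real (card C) / 2 \<le> real (card C')"
    "(\<forall>a\<in>A'. \<forall>b\<in>B'. \<forall>c\<in>C'. orient a b c < 0) \<or>
     (\<forall>a\<in>A'. \<forall>b\<in>B'. \<forall>c\<in>C'. 0 < orient a b c)"
proof -
  have "\<And>a c. a \<in> A \<Longrightarrow> c \<in> C \<Longrightarrow> slope a < slope c"
    using AB BC \<open>B \<noteq> {}\<close> by (meson ex_in_conv less_trans)
  then obtain x where x: "median (\<lambda>L. height L x) A = median (\<lambda>L. height L x) C"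
    using ham_sandwich_point assms by metis
  define h where "h L = height L x" for L
  define y where "y = median h A"
  have y: "y = median h A" "y = median h C"
    using x by (simp_all add: y_def h_def[abs_def])
  show ?thesis
  proof (cases "y \<le> median h B")
    case True
    let ?A = "{a \<in> A. h a \<le> median h A}" and ?C = "{c \<in> C. h c \<le> median h C}"
      and ?B = "{b \<in> B. median h B \<le> h b}"
    have "orient a b c < 0" if "a \<in> ?A" "b \<in> ?B" "c \<in> ?C" for a b c
      using orient_nonpos_if_above[of a b c x y] AB[of a b] BC[of b c] nz[of a b c] that True y
      by (force simp: h_def)
    then show ?thesis
      by (intro that[of ?A ?B ?C] card_le_median card_ge_median assms) blast+
  next
    case False
    let ?A = "{a \<in> A. median h A \<le> h a}" and ?C = "{c \<in> C. median h C \<le> h c}"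
      and ?B = "{b \<in> B. h b \<le> median h B}"
    have "0 < orient a b c" if "a \<in> ?A" "b \<in> ?B" "c \<in> ?C" for a b c
      using orient_nonneg_if_below[of a b c y x] AB[of a b] BC[of b c] nz[of a b c] that False y
      by (force simp: h_def)
    then show ?thesis
      by (intro that[of ?A ?B ?C] card_le_median card_ge_median assms) blast+
  qed
qed

text \<open>Finitely many requirements that survive shrinking can be met one after the other. Each costs a
  factor \<open>c\<close>, so the total loss depends only on the number of requirements.\<close>
lemma iterated_refinement:
  fixes F :: "'i \<Rightarrow> 'a set" and P :: "'q \<Rightarrow> ('i \<Rightarrow> 'a set) \<Rightarrow> bool"
  assumes "finite Q" and c: "0 < (c::real)"
    and F: "\<And>i. i \<in> I \<Longrightarrow> finite (F i) \<and> F i \<noteq> {}"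
    and hereditary: "\<And>q H H'. q \<in> Q \<Longrightarrow> P q H \<Longrightarrow> (\<And>i. i \<in> I \<Longrightarrow> H' i \<subseteq> H i) \<Longrightarrow> P q H'"
    and step: "\<And>q H. q \<in> Q \<Longrightarrow> (\<And>i. i \<in> I \<Longrightarrow> H i \<subseteq> F i \<and> H i \<noteq> {}) \<Longrightarrow>
      \<exists>H'. (\<forall>i\<in>I. H' i \<subseteq> H i \<and> c * real (card (H i)) \<le> real (card (H' i))) \<and> P q H'"
  shows "\<exists>H. (\<forall>i\<in>I. H i \<subseteq> F i \<and> H i \<noteq> {} \<and> c ^ card Q * real (card (F i)) \<le> real (card (H i))) \<and>
    (\<forall>q\<in>Q. P q H)"
  using \<open>finite Q\<close> hereditary step
proof (induction Q rule: finite_induct)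
  case empty
  then show ?case
    using F by (intro exI[of _ F]) auto
next
  case (insert q Q)
  have "\<exists>H. (\<forall>i\<in>I. H i \<subseteq> F i \<and> H i \<noteq> {} \<and> c ^ card Q * real (card (F i)) \<le> real (card (H i))) \<and>
    (\<forall>q\<in>Q. P q H)"
    by (rule insert.IH) (use insert.prems in \<open>(metis insertCI)+\<close>)
  then obtain H where H: "\<And>i. i \<in> I \<Longrightarrow> H i \<subseteq> F i \<and> H i \<noteq> {}"
      "\<And>i. i \<in> I \<Longrightarrow> c ^ card Q * real (card (F i)) \<le> real (card (H i))" "\<forall>q\<in>Q. P q H"
    by blast
  obtain H' where H': "\<And>i. i \<in> I \<Longrightarrow> H' i \<subseteq> H i"
      "\<And>i. i \<in> I \<Longrightarrow> c * real (card (H i)) \<le> real (card (H' i))" "P q H'"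
    using insert.prems(2)[of q H] H(1) by blast
  have "H' i \<subseteq> F i \<and> H' i \<noteq> {} \<and> c ^ card (insert q Q) * real (card (F i)) \<le> real (card (H' i))"
    if "i \<in> I" for i
  proof -
    have "c ^ card (insert q Q) * real (card (F i)) = c * (c ^ card Q * real (card (F i)))"
      using insert.hyps by simp
    also have "\<dots> \<le> c * real (card (H i))"
      using c H(2)[OF that] by simp
    also have "\<dots> \<le> real (card (H' i))"
      using H'(2)[OF that] .
    finally have *: "c ^ card (insert q Q) * real (card (F i)) \<le> real (card (H' i))" .
    have "0 < card (F i)"
      using F[OF that] by (simp add: card_gt_0_iff)
    then have "0 < c ^ card (insert q Q) * real (card (F i))"
      using c by simp
    then have "0 < card (H' i)"
      using * by linarith
    then show ?thesis
      using * H(1)[OF that] H'(1)[OF that] by (auto simp: card_gt_0_iff)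
  qed
  moreover have "\<forall>q\<in>insert q Q. P q H'"
    using H'(1,3) H(3) insert.prems(1) by (metis insertE insertCI)
  ultimately show ?case by blast
qed

definition same_order_type ::
    "'i set \<Rightarrow> ('i \<Rightarrow> (real^2) set) \<Rightarrow> ('i \<Rightarrow> (real^2) set) \<Rightarrow> bool" where
  "same_order_type I a b \<longleftrightarrow>
     (\<forall>i\<in>I. \<forall>j\<in>I. sgn (slope (a i) - slope (a j)) = sgn (slope (b i) - slope (b j))) \<and>
     (\<forall>i\<in>I. \<forall>j\<in>I. \<forall>k\<in>I. sgn (orient (a i) (a j) (a k)) = sgn (orient (b i) (b j) (b k)))"

lemma separate_all_slopes:
  fixes F :: "'i \<Rightarrow> (real^2) set set"
  assumes "finite I"
    and F: "\<And>i. i \<in> I \<Longrightarrow> finite (F i) \<and> F i \<noteq> {}"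
    and slopes: "\<And>i j L M. i \<in> I \<Longrightarrow> j \<in> I \<Longrightarrow> i \<noteq> j \<Longrightarrow> L \<in> F i \<Longrightarrow> M \<in> F j \<Longrightarrow>
      slope L \<noteq> slope M"
  shows "\<exists>H. (\<forall>i\<in>I. H i \<subseteq> F i \<and> H i \<noteq> {} \<and>
      (1/2) ^ card (I \<times> I) * real (card (F i)) \<le> real (card (H i))) \<and>
    (\<forall>i\<in>I. \<forall>j\<in>I. i \<noteq> j \<longrightarrow> (\<forall>L\<in>H i. \<forall>M\<in>H j. slope L < slope M) \<or>
      (\<forall>L\<in>H i. \<forall>M\<in>H j. slope M < slope L))"
proof -
  define P :: "'i \<times> 'i \<Rightarrow> ('i \<Rightarrow> (real^2) set set) \<Rightarrow> bool" where
    "P = (\<lambda>(i, j) H. i \<noteq> j \<longrightarrow> (\<forall>L\<in>H i. \<forall>M\<in>H j. slope L < slope M) \<or>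
      (\<forall>L\<in>H i. \<forall>M\<in>H j. slope M < slope L))"
  have "\<exists>H. (\<forall>i\<in>I. H i \<subseteq> F i \<and> H i \<noteq> {} \<and>
      (1/2) ^ card (I \<times> I) * real (card (F i)) \<le> real (card (H i))) \<and> (\<forall>q\<in>I \<times> I. P q H)"
  proof (rule iterated_refinement)
    fix q H H' assume "q \<in> I \<times> I" "P q H" "\<And>i. i \<in> I \<Longrightarrow> H' i \<subseteq> H i"
    then show "P q H'"
      unfolding P_def by (fastforce split: prod.splits)
  next
    fix q H assume q: "q \<in> I \<times> I" and H: "\<And>i. i \<in> I \<Longrightarrow> H i \<subseteq> F i \<and> H i \<noteq> {}"
    obtain i j where ij: "q = (i, j)" "i \<in> I" "j \<in> I"
      using q by auto
    show "\<exists>H'. (\<forall>i\<in>I. H' i \<subseteq> H i \<and> 1/2 * real (card (H i)) \<le> real (card (H' i))) \<and> P q H'"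
    proof (cases "i = j")
      case True
      then show ?thesis
        using ij by (intro exI[of _ H]) (auto simp: P_def)
    next
      case False
      have fin: "finite (H i)" "H i \<noteq> {}" "finite (H j)" "H j \<noteq> {}"
        using H ij F by (meson finite_subset)+
      have neq: "slope L \<noteq> slope M" if "L \<in> H i" "M \<in> H j" for L M
        using slopes[OF ij(2,3) False] H ij that by blast
      obtain A B where AB: "A \<subseteq> H i" "B \<subseteq> H j"
        "real (card (H i)) / 2 \<le> real (card A)" "real (card (H j)) / 2 \<le> real (card B)"
        "(\<forall>a\<in>A. \<forall>b\<in>B. slope a < slope b) \<or> (\<forall>a\<in>A. \<forall>b\<in>B. slope b < slope a)"
        by (rule separate_two_sets[OF fin neq])
      show ?thesis
        using AB False ij by (intro exI[of _ "H(i := A, j := B)"]) (auto simp: P_def)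
    qed
  qed (use assms in auto)
  then obtain H where "\<forall>i\<in>I. H i \<subseteq> F i \<and> H i \<noteq> {} \<and>
      (1/2) ^ card (I \<times> I) * real (card (F i)) \<le> real (card (H i))" "\<forall>q\<in>I \<times> I. P q H"
    by (elim exE conjE)
  then show ?thesis
    unfolding P_def by (intro exI[of _ H]) simp
qed

text \<open>The requirement is imposed on all triples of indices and is void unless they are increasing,
  so that the loss does not depend on how the families are ordered.\<close>
lemma uniform_orientation_sorted:
  fixes F :: "'i \<Rightarrow> (real^2) set set"
  assumes "finite I"
    and F: "\<And>i. i \<in> I \<Longrightarrow> finite (F i) \<and> F i \<noteq> {}"
    and nz: "\<And>i j k L M K. i \<in> I \<Longrightarrow> j \<in> I \<Longrightarrow> k \<in> I \<Longrightarrow> i \<noteq> j \<Longrightarrow> j \<noteq> k \<Longrightarrow> i \<noteq> k \<Longrightarrow>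
      L \<in> F i \<Longrightarrow> M \<in> F j \<Longrightarrow> K \<in> F k \<Longrightarrow> orient L M K \<noteq> 0"
  defines "before \<equiv> \<lambda>i j. \<forall>L\<in>F i. \<forall>M\<in>F j. slope L < slope M"
  shows "\<exists>H. (\<forall>i\<in>I. H i \<subseteq> F i \<and> H i \<noteq> {} \<and>
      (1/2) ^ card (I \<times> I \<times> I) * real (card (F i)) \<le> real (card (H i))) \<and>
    (\<forall>i\<in>I. \<forall>j\<in>I. \<forall>k\<in>I. before i j \<and> before j k \<longrightarrow>
      (\<forall>L\<in>H i. \<forall>M\<in>H j. \<forall>K\<in>H k. orient L M K < 0) \<or>
      (\<forall>L\<in>H i. \<forall>M\<in>H j. \<forall>K\<in>H k. 0 < orient L M K))"
proof -
  define P :: "'i \<times> 'i \<times> 'i \<Rightarrow> ('i \<Rightarrow> (real^2) set set) \<Rightarrow> bool" where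
    "P = (\<lambda>(i, j, k) H. before i j \<and> before j k \<longrightarrow>
      (\<forall>L\<in>H i. \<forall>M\<in>H j. \<forall>K\<in>H k. orient L M K < 0) \<or>
      (\<forall>L\<in>H i. \<forall>M\<in>H j. \<forall>K\<in>H k. 0 < orient L M K))"
  have "\<exists>H. (\<forall>i\<in>I. H i \<subseteq> F i \<and> H i \<noteq> {} \<and>
      (1/2) ^ card (I \<times> I \<times> I) * real (card (F i)) \<le> real (card (H i))) \<and>
      (\<forall>q\<in>I \<times> I \<times> I. P q H)"
  proof (rule iterated_refinement)
    fix q H H' assume "q \<in> I \<times> I \<times> I" "P q H" and sub: "\<And>i. i \<in> I \<Longrightarrow> H' i \<subseteq> H i"
    moreover obtain i j k where "q = (i, j, k)" "i \<in> I" "j \<in> I" "k \<in> I"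
      using \<open>q \<in> I \<times> I \<times> I\<close> by auto
    ultimately show "P q H'"
      using sub[of i] sub[of j] sub[of k] unfolding P_def by (simp add: subset_iff) metis
  next
    fix q H assume q: "q \<in> I \<times> I \<times> I" and H: "\<And>i. i \<in> I \<Longrightarrow> H i \<subseteq> F i \<and> H i \<noteq> {}"
    obtain i j k where ijk: "q = (i, j, k)" "i \<in> I" "j \<in> I" "k \<in> I"
      using q by auto
    show "\<exists>H'. (\<forall>i\<in>I. H' i \<subseteq> H i \<and> 1/2 * real (card (H i)) \<le> real (card (H' i))) \<and> P q H'"
    proof (cases "before i j \<and> before j k")
      case False
      then show ?thesis
        using ijk by (intro exI[of _ H]) (auto simp: P_def)
    next
      case True
      have fin: "finite (H i)" "H i \<noteq> {}" "finite (H j)" "H j \<noteq> {}" "finite (H k)" "H k \<noteq> {}"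
        using H ijk F by (meson finite_subset)+
      have ij: "slope L < slope M" if "L \<in> H i" "M \<in> H j" for L M
        using True H[OF ijk(2)] H[OF ijk(3)] that unfolding before_def by blast
      have jk: "slope L < slope M" if "L \<in> H j" "M \<in> H k" for L M
        using True H[OF ijk(3)] H[OF ijk(4)] that unfolding before_def by blast
      obtain L M K where LMK: "L \<in> H i" "M \<in> H j" "K \<in> H k"
        using fin by blast
      have distinct: "i \<noteq> j" "j \<noteq> k" "i \<noteq> k"
        using ij jk LMK by (metis less_irrefl, metis less_irrefl, metis less_asym)
      have nzH: "orient L M K \<noteq> 0" if "L \<in> H i" "M \<in> H j" "K \<in> H k" for L M K
        using nz[OF ijk(2,3,4) distinct] H[OF ijk(2)] H[OF ijk(3)] H[OF ijk(4)] that by blast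
      obtain A B C where ABC: "A \<subseteq> H i" "B \<subseteq> H j" "C \<subseteq> H k"
        "real (card (H i)) / 2 \<le> real (card A)" "real (card (H j)) / 2 \<le> real (card B)"
        "real (card (H k)) / 2 \<le> real (card C)"
        "(\<forall>a\<in>A. \<forall>b\<in>B. \<forall>c\<in>C. orient a b c < 0) \<or> (\<forall>a\<in>A. \<forall>b\<in>B. \<forall>c\<in>C. 0 < orient a b c)"
        by (rule uniform_orientation_three_families[OF fin ij jk nzH])
      show ?thesis
        using ABC distinct ijk by (intro exI[of _ "H(i := A, j := B, k := C)"]) (auto simp: P_def)
    qed
  qed (use assms in auto)
  then obtain H where "\<forall>i\<in>I. H i \<subseteq> F i \<and> H i \<noteq> {} \<and>
      (1/2) ^ card (I \<times> I \<times> I) * real (card (F i)) \<le> real (card (H i))" "\<forall>q\<in>I \<times> I \<times> I. P q H"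
    by (elim exE conjE)
  then show ?thesis
    unfolding P_def by (intro exI[of _ H]) simp
qed

text \<open>The same-type lemma for lines: the loss depends only on the number of families. First the
  slopes are separated, which orders the families; then the triples of families in increasing
  order are oriented uniformly. The remaining triples of indices follow, because exchanging two
  lines flips the sign of the orientation.\<close>
lemma same_type_lemma:
  fixes F :: "'i \<Rightarrow> (real^2) set set"
  assumes "finite I"
    and F: "\<And>i. i \<in> I \<Longrightarrow> finite (F i) \<and> F i \<noteq> {}"
    and slopes: "\<And>i j L M. i \<in> I \<Longrightarrow> j \<in> I \<Longrightarrow> i \<noteq> j \<Longrightarrow> L \<in> F i \<Longrightarrow> M \<in> F j \<Longrightarrow>
      slope L \<noteq> slope M"
    and nz: "\<And>i j k L M K. i \<in> I \<Longrightarrow> j \<in> I \<Longrightarrow> k \<in> I \<Longrightarrow> i \<noteq> j \<Longrightarrow> j \<noteq> k \<Longrightarrow> i \<noteq> k \<Longrightarrow>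
      L \<in> F i \<Longrightarrow> M \<in> F j \<Longrightarrow> K \<in> F k \<Longrightarrow> orient L M K \<noteq> 0"
  shows "\<exists>H. (\<forall>i\<in>I. H i \<subseteq> F i \<and> H i \<noteq> {} \<and>
      (1/2) ^ (card I ^ 2 + card I ^ 3) * real (card (F i)) \<le> real (card (H i))) \<and>
    (\<forall>a b. (\<forall>i\<in>I. a i \<in> H i \<and> b i \<in> H i) \<longrightarrow> same_order_type I a b)"
proof -
  obtain E where E0: "(\<forall>i\<in>I. E i \<subseteq> F i \<and> E i \<noteq> {} \<and>
      (1/2) ^ card (I \<times> I) * real (card (F i)) \<le> real (card (E i))) \<and>
    (\<forall>i\<in>I. \<forall>j\<in>I. i \<noteq> j \<longrightarrow> (\<forall>L\<in>E i. \<forall>M\<in>E j. slope L < slope M) \<or>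
      (\<forall>L\<in>E i. \<forall>M\<in>E j. slope M < slope L))"
    using separate_all_slopes[OF assms(1-3)] ..
  then have E: "\<And>i. i \<in> I \<Longrightarrow> E i \<subseteq> F i \<and> E i \<noteq> {}"
      "\<And>i. i \<in> I \<Longrightarrow> (1/2) ^ card (I \<times> I) * real (card (F i)) \<le> real (card (E i))"
    by simp_all
  have sep: "(\<forall>L\<in>E i. \<forall>M\<in>E j. slope L < slope M) \<or> (\<forall>L\<in>E i. \<forall>M\<in>E j. slope M < slope L)"
    if "i \<in> I" "j \<in> I" "i \<noteq> j" for i j
    using E0 that by simp
  define before where "before i j \<longleftrightarrow> (\<forall>L\<in>E i. \<forall>M\<in>E j. slope L < slope M)" for i j
  have total: "before i j \<or> before j i" if "i \<in> I" "j \<in> I" "i \<noteq> j" for i j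
    using sep[OF that] unfolding before_def by blast
  have finE: "finite (E i) \<and> E i \<noteq> {}" if "i \<in> I" for i
    using E(1)[OF that] F[OF that] finite_subset by blast
  have nzE: "orient L M K \<noteq> 0" if "i \<in> I" "j \<in> I" "k \<in> I" "i \<noteq> j" "j \<noteq> k" "i \<noteq> k"
      "L \<in> E i" "M \<in> E j" "K \<in> E k" for i j k L M K
    using nz[OF that(1-6)] E(1)[OF that(1)] E(1)[OF that(2)] E(1)[OF that(3)] that(7-9) by blast
  obtain H where H0: "(\<forall>i\<in>I. H i \<subseteq> E i \<and> H i \<noteq> {} \<and>
      (1/2) ^ card (I \<times> I \<times> I) * real (card (E i)) \<le> real (card (H i))) \<and>
    (\<forall>i\<in>I. \<forall>j\<in>I. \<forall>k\<in>I. before i j \<and> before j k \<longrightarrow>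
      (\<forall>L\<in>H i. \<forall>M\<in>H j. \<forall>K\<in>H k. orient L M K < 0) \<or>
      (\<forall>L\<in>H i. \<forall>M\<in>H j. \<forall>K\<in>H k. 0 < orient L M K))"
    using uniform_orientation_sorted[OF assms(1) finE nzE] unfolding before_def[symmetric] ..
  then have H: "\<And>i. i \<in> I \<Longrightarrow> H i \<subseteq> E i \<and> H i \<noteq> {}"
      "\<And>i. i \<in> I \<Longrightarrow> (1/2) ^ card (I \<times> I \<times> I) * real (card (E i)) \<le> real (card (H i))"
    by simp_all
  have uniform: "(\<forall>L\<in>H i. \<forall>M\<in>H j. \<forall>K\<in>H k. orient L M K < 0) \<or>
      (\<forall>L\<in>H i. \<forall>M\<in>H j. \<forall>K\<in>H k. 0 < orient L M K)"
    if "i \<in> I" "j \<in> I" "k \<in> I" "before i j" "before j k" for i j k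
    using H0 that by simp
  have "same_order_type I a b" if ab: "\<forall>i\<in>I. a i \<in> H i \<and> b i \<in> H i" for a b
  proof -
    have slope_sgn: "sgn (slope (a i) - slope (a j)) = sgn (slope (b i) - slope (b j))"
      if "i \<in> I" "j \<in> I" for i j
    proof (cases "i = j")
      case False
      have "a i \<in> E i" "a j \<in> E j" "b i \<in> E i" "b j \<in> E j"
        using ab H(1) that by blast+
      then show ?thesis
        using sep[OF that False] by fastforce
    qed simp
    define same where
      "same i j k \<longleftrightarrow> sgn (orient (a i) (a j) (a k)) = sgn (orient (b i) (b j) (b k))" for i j k
    have sorted: "same i j k" if "i \<in> I" "j \<in> I" "k \<in> I" "before i j" "before j k" for i j k
      using uniform[OF that] ab that(1-3) unfolding same_def by force
    have swap: "same j i k \<Longrightarrow> same i j k" "same i k j \<Longrightarrow> same i j k" for i j k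
      using orient_swap[of "a i" "a j" "a k"] orient_swap[of "b i" "b j" "b k"]
      by (simp_all add: same_def sgn_minus)
    \<comment> \<open>Equal indices give equal lines, where both orientations vanish.\<close>
    have degenerate: "same i i k" "same i j i" "same i j j" for i j k
      by (simp_all add: same_def orient_def)
    have "same i j k" if ijk: "i \<in> I" "j \<in> I" "k \<in> I" for i j k
    proof (cases "i = j \<or> i = k \<or> j = k")
      case True
      then show ?thesis
        using degenerate by metis
    next
      case False
      then show ?thesis
        using total[of i j] total[of j k] total[of i k] ijk sorted swap by metis
    qed
    with slope_sgn show ?thesis
      by (simp add: same_order_type_def same_def)
  qed
  moreover have "H i \<subseteq> F i \<and> H i \<noteq> {} \<and>
      (1/2) ^ (card I ^ 2 + card I ^ 3) * real (card (F i)) \<le> real (card (H i))"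
    if "i \<in> I" for i
  proof -
    have "(1/2) ^ (card I ^ 2 + card I ^ 3) * real (card (F i))
        = (1/2) ^ card (I \<times> I \<times> I) * ((1/2) ^ card (I \<times> I) * real (card (F i)))"
      by (simp add: power_add power2_eq_square power3_eq_cube mult.assoc
          card_cartesian_product)
    also have "\<dots> \<le> (1/2) ^ card (I \<times> I \<times> I) * real (card (E i))"
      using E(2)[OF that] by (intro mult_left_mono) auto
    also have "\<dots> \<le> real (card (H i))"
      using H(2)[OF that] .
    finally show ?thesis
      using E(1)[OF that] H(1)[OF that] by blast
  qed
  ultimately show ?thesis
    by blast
qed

section \<open>Cells and their sides\<close>

definition elevation :: "(real^2) set \<Rightarrow> real^2 \<Rightarrow> real" where
  "elevation L p = p $ 2 - height L (p $ 1)"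

lemma continuous_on_elevation: "continuous_on S (elevation L)"
  unfolding elevation_def height_def by (intro continuous_intros)

lemma connected_on_one_side:
  assumes "connected D" "\<And>p. p \<in> D \<Longrightarrow> elevation L p \<noteq> 0" "p \<in> D" "q \<in> D"
    and "0 < \<tau> * elevation L p"
  shows "0 < \<tau> * elevation L q"
proof (rule ccontr)
  assume neg: "\<not> ?thesis"
  define h where "h p = \<tau> * elevation L p" for p
  have "connected (h ` D)"
    unfolding h_def using assms(1)
    by (intro connected_continuous_image continuous_intros continuous_on_elevation)
  moreover have "h p \<in> h ` D" "h q \<in> h ` D"
    using assms(3,4) by simp_all
  moreover have "h q \<le> 0" "0 \<le> h p"
    using neg assms(5) by (simp_all add: h_def)
  ultimately have "0 \<in> h ` D"
    by (meson connectedD_interval)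
  then obtain r where "0 = h r" "r \<in> D"
    by (rule imageE)
  then have "r \<in> D" "\<tau> * elevation L r = 0"
    by (simp_all add: h_def)
  moreover have "\<tau> \<noteq> 0"
    using assms(5) by auto
  ultimately show False
    using assms(2) by auto
qed

text \<open>\<open>\<tau>\<close> chooses a side (\<open>1\<close> above, \<open>-1\<close> below) of
  every line, and thereby a polygonal region. The second part says that each line carries a
  point strictly on the chosen side of all others, i.e. contributes an edge to that region.\<close>
definition visible_sides :: "(real^2) set set \<Rightarrow> ((real^2) set \<Rightarrow> real) \<Rightarrow> bool" where
  "visible_sides G \<tau> \<longleftrightarrow> (\<forall>L\<in>G. \<bar>\<tau> L\<bar> = 1) \<and>
     (\<forall>L\<in>G. \<exists>x. \<forall>M\<in>G - {L}. 0 < \<tau> M * (height L x - height M x))"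

text \<open>The cell lies on one side of each line; these sides are the choice. A boundary segment of the
  cell on \<open>L\<close> lies weakly on the chosen sides, and it is infinite, whereas the
  other lines meet \<open>L\<close> in finitely many points only, so some point of it lies
  strictly inside.\<close>
lemma visible_sides_if_defines_cell:
  assumes "defines_cell n G"
  obtains \<tau> where "visible_sides G \<tau>"
proof -
  have gp: "general_position G" and fin: "finite G"
    using assms by (simp_all add: defines_cell_def general_position_def)
  obtain P where P: "P \<in> components (- \<Union>G)"
    and seg: "\<And>L. L \<in> G \<Longrightarrow> \<exists>a b. a \<noteq> b \<and> closed_segment a b \<subseteq> L \<inter> frontier P"
    using assms unfolding defines_cell_def by blast
  obtain p where p: "p \<in> P"
    using in_components_nonempty[OF P] by blast
  have conn: "connected P"
    using in_components_connected[OF P] .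
  have on_line: "q \<in> M \<longleftrightarrow> elevation M q = 0" if "M \<in> G" for M q
    using general_position_graph[OF gp that] by (simp add: elevation_def)
  have off: "elevation M q \<noteq> 0" if "M \<in> G" "q \<in> P" for M q
    using in_components_subset[OF P] that on_line[OF that(1)] by blast
  define \<tau> where "\<tau> M = sgn (elevation M p)" for M
  have \<tau>: "\<bar>\<tau> M\<bar> = 1" "0 < \<tau> M * elevation M p" if "M \<in> G" for M
    using off[OF that p] by (simp_all add: \<tau>_def abs_sgn_eq) (simp add: sgn_if)
  have weak: "0 \<le> \<tau> M * elevation M q" if "M \<in> G" "q \<in> closure P" for M q
  proof -
    have "closed {q. 0 \<le> \<tau> M * elevation M q}"
      by (intro closed_Collect_le continuous_intros continuous_on_elevation)
    moreover have "P \<subseteq> {q. 0 \<le> \<tau> M * elevation M q}"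
      using connected_on_one_side[OF conn off p _ \<tau>(2)] that(1) by (auto intro: less_imp_le)
    ultimately show ?thesis
      using closure_minimal that(2) by blast
  qed
  have "\<exists>x. \<forall>M\<in>G - {L}. 0 < \<tau> M * (height L x - height M x)" if L: "L \<in> G" for L
  proof -
    obtain a b where ab: "a \<noteq> b" "closed_segment a b \<subseteq> L \<inter> frontier P"
      using seg[OF L] by metis
    have "finite (L \<inter> M)" if "M \<in> G - {L}" for M
    proof -
      have M: "M \<in> G" "L \<noteq> M"
        using that by auto
      have "q = r" if qr: "q \<in> L \<inter> M" "r \<in> L \<inter> M" for q r
      proof -
        have *: "q $ 2 = height L (q $ 1)" "q $ 2 = height M (q $ 1)"
            "r $ 2 = height L (r $ 1)" "r $ 2 = height M (r $ 1)"
          using qr general_position_graph[OF gp L] general_position_graph[OF gp M(1)] by simp_all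
        then have "(slope L - slope M) * (q $ 1 - r $ 1) = 0"
          by (simp add: height_def algebra_simps)
        then have "q $ 1 = r $ 1"
          using general_position_slope_neq[OF gp L M] by simp
        with *(1,3) show ?thesis
          by (simp add: vec_eq_iff forall_2)
      qed
      then have "\<exists>q. L \<inter> M \<subseteq> {q}"
        by (metis empty_subsetI equals0I insertI1 singletonD singletonI subsetI)
      then show ?thesis
        using finite_subset by blast
    qed
    then have "finite (\<Union>M\<in>G - {L}. L \<inter> M)"
      using fin by blast
    moreover have "infinite (closed_segment a b)"
      using ab(1) by simp
    ultimately obtain q where q: "q \<in> closed_segment a b" "q \<notin> (\<Union>M\<in>G - {L}. L \<inter> M)"
      by (meson finite_subset subsetI)
    have qL: "q \<in> L" "q \<in> closure P"
      using ab(2) q(1) by (auto simp: frontier_def)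
    have "0 < \<tau> M * (height L (q $ 1) - height M (q $ 1))" if "M \<in> G - {L}" for M
    proof -
      have M: "M \<in> G"
        using that by simp
      have "q \<notin> M"
        using q(2) qL(1) that by blast
      then have "elevation M q \<noteq> 0"
        using on_line[OF M] by simp
      moreover have "\<tau> M \<noteq> 0"
        using \<tau>(1)[OF M] by auto
      ultimately have "0 < \<tau> M * elevation M q"
        using weak[OF M qL(2)] by (simp add: order_less_le)
      moreover have "elevation M q = height L (q $ 1) - height M (q $ 1)"
        using general_position_graph[OF gp L] qL(1) by (simp add: elevation_def)
      ultimately show ?thesis
        by simp
    qed
    then show ?thesis
      by metis
  qed
  with \<tau>(1) show ?thesis
    by (intro that[of \<tau>]) (simp add: visible_sides_def)
qed

text \<open>The cell is the intersection of the chosen open half-planes: it is convex, and a connected set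
  that avoids the lines cannot leave it. Near a point of \<open>L\<close> strictly on the chosen
  sides of the other lines, \<open>L\<close> stays so, and pushing off \<open>L\<close>
  vertically to its chosen side leads into the cell.\<close>
lemma defines_cell_if_visible_sides:
  assumes gp: "general_position G" and "card G \<ge> 2" and vis: "visible_sides G \<tau>"
  shows "defines_cell (card G) G"
proof -
  have fin: "finite G"
    using gp by (simp add: general_position_def)
  have \<tau>: "\<bar>\<tau> L\<bar> = 1" "\<exists>x. \<forall>M\<in>G - {L}. 0 < \<tau> M * (height L x - height M x)" if "L \<in> G" for L
    using vis that by (simp_all add: visible_sides_def)
  have on_line: "q \<in> M \<longleftrightarrow> elevation M q = 0" if "M \<in> G" for M q
    using general_position_graph[OF gp that] by (simp add: elevation_def)
  define P where "P = {p. \<forall>M\<in>G. 0 < \<tau> M * elevation M p}"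
  have P_Inter: "P = (\<Inter>M\<in>G. {p. 0 < \<tau> M * elevation M p})"
    by (auto simp: P_def)
  have "open P"
    unfolding P_Inter using fin
    by (intro open_INT ballI open_Collect_less continuous_intros continuous_on_elevation) auto
  have "convex {p. 0 < \<tau> M * elevation M p}" for M
  proof (rule convexI)
    fix p q :: "real^2" and u v :: real
    assume pq: "p \<in> {p. 0 < \<tau> M * elevation M p}" "q \<in> {p. 0 < \<tau> M * elevation M p}"
      and uv: "0 \<le> u" "0 \<le> v" "u + v = 1"
    have "elevation M (u *\<^sub>R p + v *\<^sub>R q) = u * elevation M p + v * elevation M q + (u + v - 1) * intercept M"
      by (simp add: elevation_def height_def algebra_simps)
    then have "\<tau> M * elevation M (u *\<^sub>R p + v *\<^sub>R q) = u * (\<tau> M * elevation M p) + v * (\<tau> M * elevation M q)"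
      using uv(3) by (simp add: algebra_simps)
    also have "0 < \<dots>"
      using pq uv by (cases "u = 0") (auto intro!: add_pos_nonneg)
    finally show "u *\<^sub>R p + v *\<^sub>R q \<in> {p. 0 < \<tau> M * elevation M p}"
      by simp
  qed
  then have "connected P"
    unfolding P_Inter by (intro convex_connected convex_INT)
  \<comment> \<open>Moving a distance \<open>\<eta>\<close> from \<open>q\<close> vertically, towards the chosen side of \<open>L\<close>, enters the region.\<close>
  have closure: "q \<in> closure P"
    if L: "L \<in> G" and q: "q \<in> L" "\<And>M. M \<in> G - {L} \<Longrightarrow> 0 < \<tau> M * elevation M q" for L q
  proof (rule Lim_in_closed_set)
    define f where "f \<eta> = q + \<eta> *\<^sub>R vector [0, \<tau> L]" for \<eta> :: real
    have elevation_f: "elevation M (f \<eta>) = elevation M q + \<eta> * \<tau> L" for M \<eta>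
      by (simp add: f_def elevation_def)
    show "(f \<longlongrightarrow> q) (at_right 0)"
      unfolding f_def by (rule tendsto_eq_intros refl | simp)+
    have "\<forall>\<^sub>F \<eta> in at_right 0. 0 < \<tau> M * elevation M (f \<eta>)" if M: "M \<in> G" for M
    proof (cases "M = L")
      case True
      have "0 < \<tau> M * elevation M (f \<eta>)" if "0 < \<eta>" for \<eta>
      proof -
        have "\<tau> L * \<tau> L = 1"
          using \<tau>(1)[OF L] by (metis abs_mult_self_eq mult_1)
        moreover have "elevation L q = 0"
          using on_line[OF L] q(1) by simp
        then have "\<tau> M * elevation M (f \<eta>) = \<eta> * (\<tau> L * \<tau> L)"
          by (simp add: True elevation_f)
        ultimately show ?thesis
          using that by simp
      qed
      then show ?thesis
        by (auto simp: eventually_at_right_field intro: exI[of _ 1])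
    next
      case False
      have "((\<lambda>\<eta>. \<tau> M * elevation M (f \<eta>)) \<longlongrightarrow> \<tau> M * elevation M q) (at_right 0)"
        unfolding elevation_f by (rule tendsto_eq_intros refl | simp)+
      then show ?thesis
        by (rule order_tendstoD(1)) (use q(2) M False in simp)
    qed
    then have "\<forall>\<^sub>F \<eta> in at_right 0. f \<eta> \<in> P"
      using fin by (simp add: P_def eventually_ball_finite)
    then show "\<forall>\<^sub>F \<eta> in at_right 0. f \<eta> \<in> closure P"
      by (rule eventually_mono) (use closure_subset in auto)
  qed auto
  have segment: "\<exists>a b. a \<noteq> b \<and> closed_segment a b \<subseteq> L \<inter> frontier P" if L: "L \<in> G" for L
  proof -
    obtain x where x: "\<And>M. M \<in> G - {L} \<Longrightarrow> 0 < \<tau> M * (height L x - height M x)"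
      using \<tau>(2)[OF L] by metis
    have "\<forall>\<^sub>F y in nhds x. \<forall>M\<in>G - {L}. 0 < \<tau> M * (height L y - height M y)"
    proof (rule eventually_ball_finite)
      show "\<forall>M\<in>G - {L}. \<forall>\<^sub>F y in nhds x. 0 < \<tau> M * (height L y - height M y)"
      proof
        fix M assume M: "M \<in> G - {L}"
        have "((\<lambda>y. \<tau> M * (height L y - height M y)) \<longlongrightarrow> \<tau> M * (height L x - height M x)) (nhds x)"
          unfolding height_def by (intro tendsto_intros filterlim_ident)
        then show "\<forall>\<^sub>F y in nhds x. 0 < \<tau> M * (height L y - height M y)"
          by (rule order_tendstoD(1)) (rule x[OF M])
      qed
    qed (use fin in simp)
    then obtain e where e: "e > 0" and near:
      "\<And>y M. dist y x < e \<Longrightarrow> M \<in> G - {L} \<Longrightarrow> 0 < \<tau> M * (height L y - height M y)"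
      unfolding eventually_nhds_metric by metis
    define g :: "real \<Rightarrow> real^2" where "g y = vector [y, height L y]" for y
    have g: "g y \<in> L" "elevation M (g y) = height L y - height M y" for y M
      using general_position_graph[OF gp L] by (simp_all add: g_def elevation_def)
    have frontier: "g y \<in> L \<inter> frontier P" if "dist y x < e" for y
    proof -
      have "g y \<in> closure P"
        using closure[OF L g(1)] near[OF that] by (simp add: g(2))
      moreover have "g y \<notin> P"
        using L by (auto simp: P_def g(2) intro!: bexI[of _ L])
      ultimately show ?thesis
        using g(1) \<open>open P\<close> by (simp add: frontier_def interior_open)
    qed
    have "closed_segment (g x) (g (x + e / 2)) \<subseteq> L \<inter> frontier P"
    proof
      fix q assume "q \<in> closed_segment (g x) (g (x + e / 2))"
      then obtain u where u: "0 \<le> u" "u \<le> 1" "q = (1 - u) *\<^sub>R g x + u *\<^sub>R g (x + e / 2)"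
        by (auto simp: in_segment)
      have "q = g (x + u * (e / 2))"
        by (simp add: u(3) g_def vec_eq_iff forall_2 height_def algebra_simps)
      moreover have "u * (e / 2) \<le> 1 * (e / 2)" "0 \<le> u * (e / 2)"
        using u e by (intro mult_right_mono mult_nonneg_nonneg; simp)+
      then have "dist (x + u * (e / 2)) x < e"
        using e by (simp add: dist_real_def)
      ultimately show "q \<in> L \<inter> frontier P"
        using frontier by simp
    qed
    moreover have "g x $ 1 \<noteq> g (x + e / 2) $ 1"
      using e by (simp add: g_def)
    ultimately show ?thesis
      by metis
  qed
  have "G \<noteq> {}"
    using assms(2) by auto
  then have "P \<noteq> {}"
    using segment by (auto simp: frontier_def)
  have "P \<in> components (- \<Union>G)"
    unfolding in_components_maximal
  proof (intro conjI allI impI)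
    show "P \<subseteq> - \<Union>G"
      using on_line by (auto simp: P_def)
  next
    fix D assume D: "D \<noteq> {} \<and> P \<subseteq> D \<and> D \<subseteq> - \<Union>G \<and> connected D"
    obtain p where p: "p \<in> P"
      using \<open>P \<noteq> {}\<close> by blast
    have off: "elevation M q \<noteq> 0" if "M \<in> G" "q \<in> D" for M q
      using D that on_line[OF that(1)] by blast
    have "0 < \<tau> M * elevation M q" if "q \<in> D" "M \<in> G" for q M
    proof (rule connected_on_one_side)
      show "connected D" "p \<in> D" "q \<in> D"
        using D p that by auto
      show "elevation M r \<noteq> 0" if "r \<in> D" for r
        using off[OF \<open>M \<in> G\<close> that] .
      show "0 < \<tau> M * elevation M p"
        using p \<open>M \<in> G\<close> by (simp add: P_def)
    qed
    then have "D \<subseteq> P"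
      by (auto simp: P_def)
    then show "D = P"
      using D by blast
  qed fact+
  with segment gp assms(2) show ?thesis
    unfolding defines_cell_def by blast
qed

section \<open>Cells depend only on the order type\<close>

text \<open>Helly's theorem on the line: each inequality describes an open ray, and finitely many open
  rays have a common point once every ray bounded from below meets every ray bounded from above.\<close>
lemma strict_linear_system_feasible:
  fixes \<alpha> \<beta> :: "'j \<Rightarrow> real"
  assumes "finite J" and nz: "\<And>j. j \<in> J \<Longrightarrow> \<alpha> j \<noteq> 0"
  shows "(\<exists>x. \<forall>j\<in>J. 0 < \<alpha> j * x + \<beta> j) \<longleftrightarrow>
    (\<forall>j\<in>J. \<forall>k\<in>J. 0 < \<alpha> j \<and> \<alpha> k < 0 \<longrightarrow> 0 < \<alpha> j * \<beta> k - \<alpha> k * \<beta> j)" (is "?sys \<longleftrightarrow> ?pairs")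
proof
  assume ?sys
  then obtain x where x: "\<And>j. j \<in> J \<Longrightarrow> 0 < \<alpha> j * x + \<beta> j"
    by metis
  show ?pairs
  proof (intro ballI impI)
    fix j k assume jk: "j \<in> J" "k \<in> J" and sgns: "0 < \<alpha> j \<and> \<alpha> k < 0"
    have "0 < \<alpha> j * (\<alpha> k * x + \<beta> k)" "0 < - \<alpha> k * (\<alpha> j * x + \<beta> j)"
      using x jk sgns by (intro mult_pos_pos; simp)+
    then have "0 < \<alpha> j * (\<alpha> k * x + \<beta> k) + - \<alpha> k * (\<alpha> j * x + \<beta> j)"
      by (rule add_pos_pos)
    then show "0 < \<alpha> j * \<beta> k - \<alpha> k * \<beta> j"
      by (simp add: algebra_simps)
  qed
next
  assume pairs: ?pairs
  define r where "r j = - \<beta> j / \<alpha> j" for j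
  define Lo where "Lo = r ` {j \<in> J. 0 < \<alpha> j}"
  define Hi where "Hi = r ` {j \<in> J. \<alpha> j < 0}"
  have fin: "finite Lo" "finite Hi"
    using assms(1) by (simp_all add: Lo_def Hi_def)
  have less: "l < h" if l: "l \<in> Lo" and h: "h \<in> Hi" for l h
  proof -
    obtain j where j: "l = r j" "j \<in> {j \<in> J. 0 < \<alpha> j}"
      using l unfolding Lo_def by (rule imageE)
    obtain k where k: "h = r k" "k \<in> {j \<in> J. \<alpha> j < 0}"
      using h unfolding Hi_def by (rule imageE)
    have sgns: "0 < \<alpha> j" "\<alpha> k < 0"
      using j(2) k(2) by simp_all
    have "0 < (\<alpha> j * \<beta> k - \<alpha> k * \<beta> j) / (\<alpha> j * - \<alpha> k)"
      using pairs j(2) k(2) by (intro divide_pos_pos mult_pos_pos) simp_all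
    also have "\<dots> = r k - r j"
      using sgns by (simp add: r_def divide_simps)
    finally show ?thesis
      by (simp add: j(1) k(1))
  qed
  obtain x where x: "\<And>l. l \<in> Lo \<Longrightarrow> l < x" "\<And>h. h \<in> Hi \<Longrightarrow> x < h"
  proof (cases "Lo = {} \<or> Hi = {}")
    case True
    then show ?thesis
    proof
      assume "Lo = {}"
      moreover have "Min (insert 0 Hi) - 1 < h" if "h \<in> Hi" for h
      proof -
        have "Min (insert 0 Hi) \<le> h"
          using fin(2) that by (intro Min_le) simp_all
        then show ?thesis
          by linarith
      qed
      ultimately show ?thesis
        by (intro that[of "Min (insert 0 Hi) - 1"]) simp_all
    next
      assume "Hi = {}"
      moreover have "l < Max (insert 0 Lo) + 1" if "l \<in> Lo" for l
      proof -
        have "l \<le> Max (insert 0 Lo)"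
          using fin(1) that by (intro Max_ge) simp_all
        then show ?thesis
          by linarith
      qed
      ultimately show ?thesis
        by (intro that[of "Max (insert 0 Lo) + 1"]) simp_all
    qed
  next
    case False
    then have "Max Lo < Min Hi"
      using less[of "Max Lo" "Min Hi"] fin by simp
    then obtain x where "Max Lo < x" "x < Min Hi"
      using dense by metis
    then show ?thesis
      using fin False by (intro that[of x]) simp_all
  qed
  have "0 < \<alpha> j * x + \<beta> j" if j: "j \<in> J" for j
  proof (cases "0 < \<alpha> j")
    case True
    then have "r j < x"
      using j by (intro x(1)) (simp add: Lo_def)
    then show ?thesis
      using True by (simp add: r_def field_simps)
  next
    case False
    then have neg: "\<alpha> j < 0"
      using nz[OF j] by simp
    then have "x < r j"
      using j by (intro x(2)) (simp add: Hi_def)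
    then show ?thesis
      using neg by (simp add: r_def field_simps)
  qed
  then show ?sys
    by metis
qed

text \<open>On the line \<open>L\<close>, being on the chosen side of \<open>M\<close> is a strict linear
  inequality in \<open>x\<close>. Comparing two such inequalities produces the determinant
  \<open>orient\<close>, so only signs of slope differences and of orientations matter.\<close>
lemma visible_sides_iff:
  assumes gp: "general_position G"
  shows "visible_sides G \<tau> \<longleftrightarrow> (\<forall>L\<in>G. \<bar>\<tau> L\<bar> = 1) \<and>
    (\<forall>L\<in>G. \<forall>M\<in>G - {L}. \<forall>K\<in>G - {L}.
      0 < \<tau> M * (slope L - slope M) \<and> \<tau> K * (slope L - slope K) < 0 \<longrightarrow>
      0 < \<tau> M * \<tau> K * orient L M K)"
proof -
  have visible: "(\<exists>x. \<forall>M\<in>G - {L}. 0 < \<tau> M * (height L x - height M x)) \<longleftrightarrow>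
    (\<forall>M\<in>G - {L}. \<forall>K\<in>G - {L}.
      0 < \<tau> M * (slope L - slope M) \<and> \<tau> K * (slope L - slope K) < 0 \<longrightarrow>
      0 < \<tau> M * \<tau> K * orient L M K)"
    if \<tau>: "\<forall>L\<in>G. \<bar>\<tau> L\<bar> = 1" and L: "L \<in> G" for L
  proof -
    define \<alpha> where "\<alpha> M = \<tau> M * (slope L - slope M)" for M
    define \<beta> where "\<beta> M = \<tau> M * (intercept L - intercept M)" for M
    have "finite (G - {L})"
      using gp by (simp add: general_position_def)
    moreover have "\<alpha> M \<noteq> 0" if "M \<in> G - {L}" for M
      using that \<tau> general_position_slope_neq[OF gp L] by (force simp: \<alpha>_def)
    ultimately have "(\<exists>x. \<forall>M\<in>G - {L}. 0 < \<alpha> M * x + \<beta> M) \<longleftrightarrow>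
        (\<forall>M\<in>G - {L}. \<forall>K\<in>G - {L}. 0 < \<alpha> M \<and> \<alpha> K < 0 \<longrightarrow> 0 < \<alpha> M * \<beta> K - \<alpha> K * \<beta> M)"
      by (rule strict_linear_system_feasible)
    moreover have "\<alpha> M * x + \<beta> M = \<tau> M * (height L x - height M x)" for M x
      by (simp add: \<alpha>_def \<beta>_def height_def algebra_simps)
    moreover have "\<alpha> M * \<beta> K - \<alpha> K * \<beta> M = \<tau> M * \<tau> K * orient L M K" for M K
      by (simp add: \<alpha>_def \<beta>_def orient_def algebra_simps)
    ultimately show ?thesis
      unfolding \<alpha>_def by simp
  qed
  show ?thesis
    unfolding visible_sides_def by (intro conj_cong ball_cong refl visible)
qed

lemma defines_cell_same_order_type:
  assumes cell: "defines_cell n (a ` I)" and inj: "inj_on a I" "inj_on b I"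
    and gp: "general_position (b ` I)" and type: "same_order_type I a b"
  shows "defines_cell n (b ` I)"
proof -
  have gpa: "general_position (a ` I)" and n: "card (a ` I) = n" "n \<ge> 2"
    using cell by (simp_all add: defines_cell_def)
  then have card: "card (b ` I) = n"
    using inj by (simp add: card_image)
  obtain \<tau> where "visible_sides (a ` I) \<tau>"
    using visible_sides_if_defines_cell[OF cell] .
  then have vis: "(\<forall>L\<in>a ` I. \<bar>\<tau> L\<bar> = 1) \<and>
    (\<forall>L\<in>a ` I. \<forall>M\<in>a ` I - {L}. \<forall>K\<in>a ` I - {L}.
      0 < \<tau> M * (slope L - slope M) \<and> \<tau> K * (slope L - slope K) < 0 \<longrightarrow>
      0 < \<tau> M * \<tau> K * orient L M K)"
    by (simp only: visible_sides_iff[OF gpa])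
  then have \<tau>: "\<bar>\<tau> (a i)\<bar> = 1" if "i \<in> I" for i
    using that by simp
  have crit: "0 < \<tau> (a j) * \<tau> (a k) * orient (a i) (a j) (a k)"
    if "i \<in> I" "j \<in> I" "k \<in> I" "j \<noteq> i" "k \<noteq> i"
      "0 < \<tau> (a j) * (slope (a i) - slope (a j))" "\<tau> (a k) * (slope (a i) - slope (a k)) < 0"
    for i j k
  proof -
    have "a j \<noteq> a i" "a k \<noteq> a i"
      using inj_onD[OF inj(1)] that(1-5) by metis+
    then show ?thesis
      using vis that by simp
  qed
  define \<sigma> where "\<sigma> M = \<tau> (a (inv_into I b M))" for M
  have \<sigma>: "\<sigma> (b i) = \<tau> (a i)" if "i \<in> I" for i
    using that inj(2) by (simp add: \<sigma>_def)
  have sgn_slope: "sgn (slope (b i) - slope (b j)) = sgn (slope (a i) - slope (a j))"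
    if "i \<in> I" "j \<in> I" for i j
    using type that by (simp add: same_order_type_def)
  have sgn_orient: "sgn (orient (b i) (b j) (b k)) = sgn (orient (a i) (a j) (a k))"
    if "i \<in> I" "j \<in> I" "k \<in> I" for i j k
    using type that by (simp add: same_order_type_def)
  have pos_cong: "0 < c * u \<longleftrightarrow> 0 < c * v" and neg_cong: "c * u < 0 \<longleftrightarrow> c * v < 0"
    if "sgn u = sgn v" for c u v :: real
    using that by (metis sgn_greater sgn_mult, metis sgn_less sgn_mult)
  have "visible_sides (b ` I) \<sigma>"
    unfolding visible_sides_iff[OF gp]
  proof (intro conjI ballI impI)
    fix L assume "L \<in> b ` I"
    then show "\<bar>\<sigma> L\<bar> = 1"
      using \<sigma> \<tau> by auto
  next
    fix L M K
    assume "L \<in> b ` I" and MK: "M \<in> b ` I - {L}" "K \<in> b ` I - {L}"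
      and slopes: "0 < \<sigma> M * (slope L - slope M) \<and> \<sigma> K * (slope L - slope K) < 0"
    obtain i where i: "i \<in> I" "L = b i"
      using \<open>L \<in> b ` I\<close> by auto
    obtain j where j: "j \<in> I" "M = b j"
      using MK(1) by auto
    obtain k where k: "k \<in> I" "K = b k"
      using MK(2) by auto
    have neq: "j \<noteq> i" "k \<noteq> i"
      using MK i j k by auto
    have "0 < \<tau> (a j) * (slope (a i) - slope (a j))" "\<tau> (a k) * (slope (a i) - slope (a k)) < 0"
      using slopes pos_cong[OF sgn_slope[OF i(1) j(1)]] neg_cong[OF sgn_slope[OF i(1) k(1)]]
      by (simp_all add: i j k \<sigma>)
    then have "0 < \<tau> (a j) * \<tau> (a k) * orient (a i) (a j) (a k)"
      by (rule crit[OF i(1) j(1) k(1) neq])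
    then show "0 < \<sigma> M * \<sigma> K * orient L M K"
      using pos_cong[OF sgn_orient[OF i(1) j(1) k(1)]] by (simp add: i j k \<sigma>)
  qed
  then show ?thesis
    using defines_cell_if_visible_sides[OF gp] card n by simp
qed

section \<open>Existence of the Erdos-Szekeres number for lines\<close>

text \<open>A cup or a cap: the lines form an upper envelope (for \<open>\<epsilon> = -1\<close>) or a
  lower envelope (for \<open>\<epsilon> = 1\<close>) to which each of them contributes, so all
  chosen sides agree.\<close>
lemma defines_cell_if_uniformly_oriented:
  assumes gp: "general_position G" and "card G \<ge> 2" and \<epsilon>: "\<bar>\<epsilon>\<bar> = (1::real)"
    and uniform: "\<And>L M K. L \<in> G \<Longrightarrow> M \<in> G \<Longrightarrow> K \<in> G \<Longrightarrow> slope L < slope M \<Longrightarrow>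
      slope M < slope K \<Longrightarrow> 0 < \<epsilon> * orient L M K"
  shows "defines_cell (card G) G"
proof (rule defines_cell_if_visible_sides[OF gp assms(2)])
  show "visible_sides G (\<lambda>_. - \<epsilon>)"
    unfolding visible_sides_iff[OF gp]
  proof (intro conjI ballI impI)
    fix L M K assume LMK: "L \<in> G" "M \<in> G - {L}" "K \<in> G - {L}"
      and s: "0 < - \<epsilon> * (slope L - slope M) \<and> - \<epsilon> * (slope L - slope K) < 0"
    consider "\<epsilon> = 1" | "\<epsilon> = - 1"
      using \<epsilon> by linarith
    then show "0 < - \<epsilon> * - \<epsilon> * orient L M K"
    proof cases
      case 1
      then have "0 < orient K L M"
        using uniform[of K L M] LMK s by simp
      then show ?thesis
        using 1 by (simp add: orient_def algebra_simps)
    next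
      case 2
      then have "orient M L K < 0"
        using uniform[of M L K] LMK s by simp
      then show ?thesis
        using 2 by (simp add: orient_def algebra_simps)
    qed
  qed (use \<epsilon> in simp)
qed

text \<open>Ramsey's theorem for triples, coloured by the orientation in order of increasing slope, yields
  a uniformly oriented subfamily. This makes the number \<open>ES\<^sub>l\<close>, defined as a
  least element, meaningful.\<close>
lemma erdos_szekeres_lines:
  assumes "n \<ge> 2"
  shows "\<exists>N. \<forall>F. general_position F \<and> card F \<ge> N \<longrightarrow> (\<exists>G\<subseteq>F. defines_cell n G)"
proof -
  obtain N :: nat where N: "partn_lst {..<N} [n, n] 3"
    using ramsey_full[of "[n, n]" 3] by metis
  have "\<exists>G\<subseteq>F. defines_cell n G" if gp: "general_position F" and "card F \<ge> N" for F
  proof -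
    have "finite F"
      using gp by (simp add: general_position_def)
    then obtain e where e: "bij_betw e {..<card F} F"
      using ex_bij_betw_nat_finite by (metis lessThan_atLeast0)
    have eF: "e i \<in> F" if "i < N" for i
      using e that \<open>card F \<ge> N\<close> by (auto dest: bij_betwE)
    have e_inj: "e i \<noteq> e j" if "i < N" "j < N" "i \<noteq> j" for i j
      using e that \<open>card F \<ge> N\<close> unfolding bij_betw_def by (meson inj_onD lessThan_iff order_less_le_trans)
    define colour where "colour X = (if \<exists>i j k. X = {i, j, k} \<and>
      slope (e i) < slope (e j) \<and> slope (e j) < slope (e k) \<and> 0 < orient (e i) (e j) (e k)
      then 1 else 0 :: nat)" for X
    have "colour \<in> nsets {..<N} 3 \<rightarrow> {..<2}"
      by (simp add: colour_def)
    then obtain c H where H: "c < length [n, n]" "H \<in> nsets {..<N} ([n, n] ! c)"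
        "colour ` nsets H 3 \<subseteq> {c}"
      by (rule partn_lstE[OF N]) simp
    then have HN: "H \<subseteq> {..<N}" "finite H" "card H = n"
      by (auto simp: nsets_def less_2_cases_iff nth_Cons')
    define G where "G = e ` H"
    have GF: "G \<subseteq> F"
      using HN(1) eF by (auto simp: G_def)
    have "inj_on e H"
      using HN(1) e_inj by (meson inj_onI lessThan_iff subsetD)
    then have cardG: "card G = n"
      using HN(3) by (simp add: G_def card_image)
    have gpG: "general_position G"
      using general_position_subset[OF gp GF] .
    define \<epsilon> :: real where "\<epsilon> = (if c = 1 then 1 else - 1)"
    have "defines_cell (card G) G"
    proof (rule defines_cell_if_uniformly_oriented[OF gpG, of \<epsilon>])
      fix L M K assume "L \<in> G" "M \<in> G" "K \<in> G" and s: "slope L < slope M" "slope M < slope K"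
      then obtain i j k where ijk: "i \<in> H" "j \<in> H" "k \<in> H" "L = e i" "M = e j" "K = e k"
        by (auto simp: G_def)
      then have "i \<noteq> j" "j \<noteq> k" "i \<noteq> k"
        using s by auto
      then have "{i, j, k} \<in> nsets H 3"
        using ijk by (auto simp: nsets_def card_insert_if)
      then have "colour {i, j, k} = c"
        using H(3) by blast
      show "0 < \<epsilon> * orient L M K"
      proof (cases "0 < orient L M K")
        case True
        then have "colour {i, j, k} = 1"
          using s ijk unfolding colour_def by auto
        then show ?thesis
          using True \<open>colour {i, j, k} = c\<close> by (simp add: \<epsilon>_def)
      next
        case False
        \<comment> \<open>The increasing order of slopes is unique, so no relabelling of the triple is positive.\<close>
        have "colour {i, j, k} = 0"
        proof -
          have "i' = i \<and> j' = j \<and> k' = k" if eq: "{i, j, k} = {i', j', k'}"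
            and s': "slope (e i') < slope (e j')" "slope (e j') < slope (e k')" for i' j' k'
          proof -
            have "i \<in> {i', j', k'}" "j \<in> {i', j', k'}" "k \<in> {i', j', k'}"
              unfolding eq[symmetric] by simp_all
            then show ?thesis
              using s s' unfolding ijk by auto
          qed
          then show ?thesis
            using False unfolding colour_def ijk by metis
        qed
        then have "c = 0"
          using \<open>colour {i, j, k} = c\<close> by simp
        moreover have "L \<noteq> M" "M \<noteq> K" "L \<noteq> K"
          using s by auto
        then have "orient L M K \<noteq> 0"
          by (rule general_position_orient_neq[OF gpG \<open>L \<in> G\<close> \<open>M \<in> G\<close> \<open>K \<in> G\<close>])
        ultimately show ?thesis
          using False by (simp add: \<epsilon>_def)
      qed
    qed (use assms cardG in \<open>simp_all add: \<epsilon>_def\<close>)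
    with GF cardG show ?thesis
      by (intro exI[of _ G]) simp
  qed
  then show ?thesis
    by (intro exI[of _ N] allI impI) simp
qed

lemma ES_cell_exists:
  assumes "n \<ge> 2" "general_position F" "card F \<ge> ES\<^sub>l n"
  obtains G where "G \<subseteq> F" "defines_cell n G"
proof -
  have "\<forall>F. general_position F \<and> card F \<ge> ES\<^sub>l n \<longrightarrow> (\<exists>G\<subseteq>F. defines_cell n G)"
    unfolding ES\<^sub>l_def by (rule LeastI_ex[OF erdos_szekeres_lines[OF assms(1)]])
  then have "\<exists>G\<subseteq>F. defines_cell n G"
    using assms(2,3) by simp
  then show ?thesis
    using that by metis
qed

section \<open>Positive fractions of families all of whose transversals define cells\<close>

theorem theorem6p2:
  fixes n :: nat
  assumes "n \<ge> 2"
  shows "\<exists>C::real. C > 0 \<and>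
    (\<forall>(F :: (real^2) set set) (Fs :: nat \<Rightarrow> (real^2) set set) (m::nat).
       m = ES\<^sub>l n \<longrightarrow> general_position F \<longrightarrow>
       F = (\<Union>i\<in>{1..m}. Fs i) \<longrightarrow> disjoint_family_on Fs {1..m} \<longrightarrow>
       (\<forall>i\<in>{1..m}. Fs i \<noteq> {}) \<longrightarrow>
       (\<exists>(j :: nat \<Rightarrow> nat) (H :: nat \<Rightarrow> (real^2) set set).
          strict_mono_on {1..n} j \<and> j ` {1..n} \<subseteq> {1..m} \<and>
          (\<forall>i\<in>{1..n}. H (j i) \<subseteq> Fs (j i) \<and>
             real (card (H (j i))) \<ge> C * real (card (Fs (j i)))) \<and>
          (\<forall>T. transversal n (\<lambda>i. H (j i)) T \<longrightarrow> defines_cell n T)))"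
proof (intro exI[of _ "(1/2) ^ (ES\<^sub>l n ^ 2 + ES\<^sub>l n ^ 3)"] conjI allI impI)
  fix F :: "(real^2) set set" and Fs :: "nat \<Rightarrow> (real^2) set set" and m :: nat
  assume m: "m = ES\<^sub>l n" and gp: "general_position F" and F: "F = (\<Union>i\<in>{1..m}. Fs i)"
    and disj: "disjoint_family_on Fs {1..m}" and ne: "\<forall>i\<in>{1..m}. Fs i \<noteq> {}"
  define I where "I = {1..m}"
  have "card I = ES\<^sub>l n"
    by (simp add: I_def m)
  have FsF: "L \<in> F" if "i \<in> I" "L \<in> Fs i" for i L
    using that by (auto simp: F I_def)
  have distinct: "L \<noteq> M" if "i \<in> I" "j \<in> I" "i \<noteq> j" "L \<in> Fs i" "M \<in> Fs j" for i j L M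
    using disj that unfolding disjoint_family_on_def I_def by blast
  have Fs: "finite (Fs i) \<and> Fs i \<noteq> {}" if "i \<in> I" for i
  proof -
    have "Fs i \<subseteq> F"
      using FsF[OF that] by blast
    then show ?thesis
      using gp ne that finite_subset by (auto simp: general_position_def I_def)
  qed
  obtain H where H0: "(\<forall>i\<in>I. H i \<subseteq> Fs i \<and> H i \<noteq> {} \<and>
      (1/2) ^ (card I ^ 2 + card I ^ 3) * real (card (Fs i)) \<le> real (card (H i))) \<and>
    (\<forall>a b. (\<forall>i\<in>I. a i \<in> H i \<and> b i \<in> H i) \<longrightarrow> same_order_type I a b)"
  proof (rule exE[OF same_type_lemma[of I Fs]])
    fix i j L M assume "i \<in> I" "j \<in> I" "i \<noteq> j" "L \<in> Fs i" "M \<in> Fs j"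
    then show "slope L \<noteq> slope M"
      using general_position_slope_neq[OF gp] FsF distinct by metis
  next
    fix i j k L M K
    assume ijk: "i \<in> I" "j \<in> I" "k \<in> I" "i \<noteq> j" "j \<noteq> k" "i \<noteq> k"
      and "L \<in> Fs i" "M \<in> Fs j" "K \<in> Fs k"
    then show "orient L M K \<noteq> 0"
      by (intro general_position_orient_neq[OF gp] FsF[of i] FsF[of j] FsF[of k]
          distinct[of i j] distinct[of j k] distinct[of i k])
  qed (use Fs in \<open>simp_all add: I_def\<close>)
  then have H: "\<And>i. i \<in> I \<Longrightarrow> H i \<subseteq> Fs i" "\<And>i. i \<in> I \<Longrightarrow> H i \<noteq> {}"
      "\<And>i. i \<in> I \<Longrightarrow> (1/2) ^ (card I ^ 2 + card I ^ 3) * real (card (Fs i)) \<le> real (card (H i))"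
    and type: "\<And>a b. (\<And>i. i \<in> I \<Longrightarrow> a i \<in> H i \<and> b i \<in> H i) \<Longrightarrow> same_order_type I a b"
    by simp_all
  have inj: "inj_on c J" if "J \<subseteq> I" "\<And>i. i \<in> J \<Longrightarrow> c i \<in> H i" for c J
  proof (rule inj_onI, rule ccontr)
    fix i j assume "i \<in> J" "j \<in> J" "c i = c j" "i \<noteq> j"
    moreover from this have "i \<in> I" "j \<in> I" "c i \<in> Fs i" "c j \<in> Fs j"
      using that H(1) by (meson subsetD)+
    ultimately show False
      using distinct by metis
  qed
  have gp_image: "general_position (c ` J)" if "J \<subseteq> I" "\<And>i. i \<in> J \<Longrightarrow> c i \<in> H i" for c J
  proof (rule general_position_subset[OF gp])
    show "c ` J \<subseteq> F"
    proof (rule image_subsetI)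
      fix i assume "i \<in> J"
      then have "i \<in> I" "c i \<in> H i"
        using that by (simp_all add: subset_iff)
      then show "c i \<in> F"
        using H(1)[of i] FsF[of i] by (simp add: subset_iff)
    qed
  qed
  \<comment> \<open>One transversal of all \<open>m\<close> families contains a cell; its indices are the required subscripts.\<close>
  define a where "a i = (SOME L. L \<in> H i)" for i
  have a: "a i \<in> H i" if "i \<in> I" for i
    using H(2)[OF that] by (simp add: a_def some_in_eq)
  have "card (a ` I) = ES\<^sub>l n"
    using inj[of I a] a m by (simp add: card_image I_def)
  then obtain G where G: "G \<subseteq> a ` I" "defines_cell n G"
    using ES_cell_exists[OF assms gp_image[of I a]] a by (metis order_refl)
  then obtain J where J: "J \<subseteq> I" "G = a ` J"
    by (auto simp: subset_image_iff)
  have injJ: "inj_on a J"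
    by (rule inj[OF J(1)]) (use a J(1) in auto)
  have cardJ: "card J = n"
    using G(2) injJ by (simp add: defines_cell_def J(2) card_image)
  obtain h where h: "bij_betw h {..<card J} J" "strict_mono_on {..<card J} h"
    using ex_bij_betw_strict_mono_card[of J] finite_subset[OF J(1)] by (auto simp: I_def)
  \<comment> \<open>The enumeration \<open>h\<close> starts at \<open>0\<close>, the subscripts at \<open>1\<close>.\<close>
  define j where "j i = h (i - 1)" for i
  have j_image: "j ` {1..n} = J"
  proof -
    have "(\<lambda>i. i - 1) ` {1..n} = {..<n}"
      by (auto simp: image_iff intro!: bexI[of _ "Suc _"])
    then have "j ` {1..n} = h ` {..<n}"
      by (metis (no_types, lifting) image_cong image_image j_def)
    then show ?thesis
      using h(1) by (simp add: bij_betw_def cardJ)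
  qed
  have j_mono: "strict_mono_on {1..n} j"
  proof (rule strict_mono_onI)
    fix r s :: nat assume rs: "r \<in> {1..n}" "s \<in> {1..n}" "r < s"
    then have "r - 1 \<in> {..<card J}" "s - 1 \<in> {..<card J}" "r - 1 < s - 1"
      by (auto simp: cardJ)
    then show "j r < j s"
      unfolding j_def by (rule strict_mono_onD[OF h(2)])
  qed
  have "defines_cell n T" if T: "transversal n (\<lambda>i. H (j i)) T" for T
  proof -
    obtain b where b: "\<forall>i\<in>{1..n}. b i \<in> H (j i)" "T = b ` {1..n}"
      using T unfolding transversal_def by auto
    \<comment> \<open>Extend the given transversal by \<open>a\<close> to all families, where the same-type lemma applies.\<close>
    define c where "c l = (if l \<in> J then b (inv_into {1..n} j l) else a l)" for l
    have j_inj: "inj_on j {1..n}"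
      using j_mono by (rule strict_mono_on_imp_inj_on)
    have cj: "c (j i) = b i" if "i \<in> {1..n}" for i
      using that j_inj j_image by (auto simp: c_def)
    have cH: "c l \<in> H l" if "l \<in> I" for l
    proof (cases "l \<in> J")
      case True
      then obtain i where "i \<in> {1..n}" "l = j i"
        using j_image by auto
      then show ?thesis
        using b(1) cj by simp
    qed (simp add: c_def a that)
    have "T = c ` J"
      unfolding b(2) j_image[symmetric] image_image using cj by (intro image_cong) simp_all
    have "same_order_type I a c"
      using a cH by (intro type) simp
    then have "same_order_type J a c"
      using J(1) unfolding same_order_type_def by (simp add: subset_iff)
    moreover have "c l \<in> H l" if "l \<in> J" for l
      using cH J(1) that by blast
    ultimately have "defines_cell n (c ` J)"
      using defines_cell_same_order_type[of n a J c] G(2) J(2) injJ inj[OF J(1)] gp_image[OF J(1)]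
      by simp
    then show ?thesis
      by (simp add: \<open>T = c ` J\<close>)
  qed
  moreover have "H (j i) \<subseteq> Fs (j i) \<and> real (card (H (j i))) \<ge>
      (1/2) ^ (ES\<^sub>l n ^ 2 + ES\<^sub>l n ^ 3) * real (card (Fs (j i)))"
    if "i \<in> {1..n}" for i
  proof -
    have "j i \<in> I"
      using j_image J(1) that by blast
    then show ?thesis
      using H(1,3) \<open>card I = ES\<^sub>l n\<close> by simp
  qed
  moreover have "j ` {1..n} \<subseteq> {1..m}"
    using j_image J(1) by (simp add: I_def)
  ultimately show "\<exists>j H. strict_mono_on {1..n} j \<and> j ` {1..n} \<subseteq> {1..m} \<and>
      (\<forall>i\<in>{1..n}. H (j i) \<subseteq> Fs (j i) \<and> real (card (H (j i))) \<ge>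
        (1/2) ^ (ES\<^sub>l n ^ 2 + ES\<^sub>l n ^ 3) * real (card (Fs (j i)))) \<and>
      (\<forall>T. transversal n (\<lambda>i. H (j i)) T \<longrightarrow> defines_cell n T)"
    using j_mono by (intro exI[of _ j] exI[of _ H]) simp
qed simp

end
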